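(* For every natural number $n\ge 2$, the sublinear Higson corona $\nu_L\mathbb{R}^n$ of the Euclidean space $\mathbb{R}^n$ with the usual metric is a mutually aposyndetic continuum.
   Context: Let $(X,d)$ be a noncompact proper metric space (every closed ball $\{y\in X : d(x,y)\le r\}$ is compact), with a fixed base point $x_0\in X$; write $|x|=d(x,x_0)$ and $B_d(x,r)=\{y\in X : d(x,y)<r\}$. (For $X=\mathbb{R}^n$ with the usual metric one may take the origin as base point.) A (not necessarily continuous) function $s:\mathbb{R}_+\to\mathbb{R}_+$ on the set of positive real numbers is asymptotically sublinear if for every $\alpha>0$ there is $t_0>0$ such that $s(t)<\alpha t$ for all $t>t_0$. Let $\mathcal{L}$ be the set of all asymptotically sublinear functions. Let $C^*(X)$ be the ring of bounded continuous real-valued functions on $X$, and let $C_L(X)$ be the set of all $f\in C^*(X)$ such that for every $s\in\mathcal{L}$, $\lim_{|x|\to\infty}\operatorname{diam} f(B_d(x,s(|x|)))=0$, i.e. for every $s\in\mathcal L$ and $\varepsilon>0$ there is $r_0>0$ such that $\operatorname{diam} f(B_d(x,s(|x|)))<\varepsilon$ for all $x\in X$ with $|x|>r_0$. $C_L(X)$ is a closed subring of $C^*(X)$ which contains the constants and generates the topology of $X$. The sublinear Higson compactification $h_L X$ is the unique (Hausdorff) compactification of $X$ associated with $C_L(X)$; it is characterized by: a bounded continuous $f:X\to\mathbb{R}$ extends continuously to $h_L X$ if and only if $f\in C_L(X)$. The sublinear Higson corona is $\nu_L X=h_L X\setminus X$ with the subspace topology. A continuum is a compact connected Hausdorff space;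 a subcontinuum is a continuum contained in a space. For a continuum $Z$ and $p\in Z$, a continuum neighborhood of $p$ is a subcontinuum $W$ of $Z$ with $p$ in the interior of $W$ in $Z$. A continuum $Z$ is mutually aposyndetic if every two distinct points of $Z$ have disjoint continuum neighborhoods. *)

theory Defs
  imports "HOL-Analysis.Analysis"
begin

section \<open>Sublinear Higson compactification and corona\<close>

text \<open>Functions on the positive reals are represented by functions of type
  \<open>real \<Rightarrow> real\<close> whose values at nonpositive arguments are never used.\<close>

definition asymptotically_sublinear :: "(real \<Rightarrow> real) set" where
  "asymptotically_sublinear =
     {s. (\<forall>t>0. s t > 0) \<and> (\<forall>\<alpha>>0. \<exists>t0>0. \<forall>t>t0. s t < \<alpha> * t)}"

definition sublinear_Higson_functions :: "'a::metric_space \<Rightarrow> ('a \<Rightarrow> real) set" where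
  "sublinear_Higson_functions x0 =
     {f. continuous_on UNIV f \<and> bounded (range f) \<and>
         (\<forall>s\<in>asymptotically_sublinear. \<forall>\<epsilon>>0. \<exists>r0>0. \<forall>x.
            dist x x0 > r0 \<longrightarrow> diameter (f ` ball x (s (dist x x0))) < \<epsilon>)}"

text \<open>The compactification associated with a ring of bounded continuous functions is the
  closure of the image of the space under the evaluation map into the product of copies of
  the real line indexed by that ring; its characteristic property is proved below.\<close>

definition sublinear_Higson_embedding :: "'a::metric_space \<Rightarrow> 'a \<Rightarrow> ('a \<Rightarrow> real) \<Rightarrow> real" where
  "sublinear_Higson_embedding x0 x = (\<lambda>f\<in>sublinear_Higson_functions x0. f x)"

definition sublinear_Higson_compactification :: "'a::metric_space \<Rightarrow> (('a \<Rightarrow> real) \<Rightarrow> real) topology" where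
  "sublinear_Higson_compactification x0 =
     (let P = product_topology (\<lambda>_. euclideanreal) (sublinear_Higson_functions x0)
      in subtopology P (P closure_of range (sublinear_Higson_embedding x0)))"

definition sublinear_Higson_corona :: "'a::metric_space \<Rightarrow> (('a \<Rightarrow> real) \<Rightarrow> real) topology" where
  "sublinear_Higson_corona x0 =
     subtopology (sublinear_Higson_compactification x0)
       (topspace (sublinear_Higson_compactification x0) - range (sublinear_Higson_embedding x0))"

section \<open>Continua\<close>

definition continuum :: "'a topology \<Rightarrow> bool" where
  "continuum Z \<longleftrightarrow> compact_space Z \<and> connected_space Z \<and> Hausdorff_space Z"

definition subcontinuum :: "'a topology \<Rightarrow> 'a set \<Rightarrow> bool" where
  "subcontinuum Z W \<longleftrightarrow> W \<subseteq> topspace Z \<and> continuum (subtopology Z W)"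

definition continuum_neighborhood :: "'a topology \<Rightarrow> 'a \<Rightarrow> 'a set \<Rightarrow> bool" where
  "continuum_neighborhood Z p W \<longleftrightarrow> subcontinuum Z W \<and> p \<in> Z interior_of W"

definition mutually_aposyndetic :: "'a topology \<Rightarrow> bool" where
  "mutually_aposyndetic Z \<longleftrightarrow>
     (\<forall>p\<in>topspace Z. \<forall>q\<in>topspace Z. p \<noteq> q \<longrightarrow>
        (\<exists>U V. continuum_neighborhood Z p U \<and> continuum_neighborhood Z q V \<and> U \<inter> V = {}))"

section \<open>The compactification has its characteristic property\<close>

lemma sublinear_Higson_functions_iff:
  "f \<in> sublinear_Higson_functions x0 \<longleftrightarrow>
     continuous_on UNIV f \<and> bounded (range f) \<and>
     (\<forall>s\<in>asymptotically_sublinear. \<forall>\<epsilon>>0. \<exists>r0>0. \<forall>x.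
        dist x x0 > r0 \<longrightarrow> (\<forall>y. dist x y < s (dist x x0) \<longrightarrow> \<bar>f x - f y\<bar> < \<epsilon>))"
    (is "_ \<longleftrightarrow> ?C \<and> ?B \<and> ?D")
proof (intro iffI conjI ballI allI impI)
  assume f: "f \<in> sublinear_Higson_functions x0"
  show ?C ?B using f by (auto simp: sublinear_Higson_functions_def)
  fix s and \<epsilon> :: real assume s: "s \<in> asymptotically_sublinear" and e: "\<epsilon> > 0"
  obtain r0 where r0: "r0 > 0"
    "\<And>x. dist x x0 > r0 \<Longrightarrow> diameter (f ` ball x (s (dist x x0))) < \<epsilon>"
    using f s e unfolding sublinear_Higson_functions_def by blast
  show "\<exists>r0>0. \<forall>x. dist x x0 > r0 \<longrightarrow> (\<forall>y. dist x y < s (dist x x0) \<longrightarrow> \<bar>f x - f y\<bar> < \<epsilon>)"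
  proof (intro exI[of _ r0] conjI allI impI r0(1))
    fix x y assume x: "dist x x0 > r0" and y: "dist x y < s (dist x x0)"
    have "bounded (f ` ball x (s (dist x x0)))"
      using \<open>?B\<close> by (rule bounded_subset) auto
    moreover have "x \<in> ball x (s (dist x x0))"
      using order.strict_trans1[OF zero_le_dist y] by simp
    ultimately have "dist (f x) (f y) \<le> diameter (f ` ball x (s (dist x x0)))"
      using y by (intro diameter_bounded_bound) auto
    then show "\<bar>f x - f y\<bar> < \<epsilon>" using r0(2)[OF x] by (simp add: dist_real_def)
  qed
next
  assume a: "?C \<and> ?B \<and> ?D"
  have "\<exists>r0>0. \<forall>x. dist x x0 > r0 \<longrightarrow> diameter (f ` ball x (s (dist x x0))) < \<epsilon>"
    if s: "s \<in> asymptotically_sublinear" and e: "\<epsilon> > 0" for s and \<epsilon> :: real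
  proof -
    have e4: "\<epsilon> / 4 > 0" using e by simp
    obtain r0 where r0: "r0 > 0"
      "\<And>x y. dist x x0 > r0 \<Longrightarrow> dist x y < s (dist x x0) \<Longrightarrow> \<bar>f x - f y\<bar> < \<epsilon> / 4"
      using a s e4 by metis
    show ?thesis
    proof (intro exI[of _ r0] conjI allI impI r0(1))
      fix x assume x: "dist x x0 > r0"
      have "diameter (f ` ball x (s (dist x x0))) \<le> \<epsilon> / 2"
      proof (rule diameter_le)
        fix u v assume "u \<in> f ` ball x (s (dist x x0))" "v \<in> f ` ball x (s (dist x x0))"
        then obtain y z where "u = f y" "v = f z"
          "dist x y < s (dist x x0)" "dist x z < s (dist x x0)" by auto
        with r0(2)[OF x, of y] r0(2)[OF x, of z] show "norm (u - v) \<le> \<epsilon> / 2"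
          by (simp add: abs_if split: if_splits)
      qed (use e in auto)
      then show "diameter (f ` ball x (s (dist x x0))) < \<epsilon>" using e by linarith
    qed
  qed
  then show "f \<in> sublinear_Higson_functions x0"
    using a unfolding sublinear_Higson_functions_def by blast
qed

lemma sublinear_Higson_functions_bump:
  fixes a :: "'a::metric_space"
  assumes "r > 0"
  shows "(\<lambda>x. max 0 (r - dist a x)) \<in> sublinear_Higson_functions x0" (is "?f \<in> _")
  unfolding sublinear_Higson_functions_iff
proof (intro conjI ballI allI impI)
  show "continuous_on UNIV ?f" by (intro continuous_intros)
  show "bounded (range ?f)" using assms by (auto intro!: boundedI[of _ r])
  fix s and \<epsilon> :: real assume s: "s \<in> asymptotically_sublinear" and e: "\<epsilon> > 0"
  have "(1 / 2 :: real) > 0" by simp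
  then obtain t0 where t0: "t0 > 0" "\<And>t. t > t0 \<Longrightarrow> s t < 1 / 2 * t"
    using s unfolding asymptotically_sublinear_def by blast
  let ?r = "max t0 (2 * (r + dist a x0))"
  show "\<exists>r0>0. \<forall>x. dist x x0 > r0 \<longrightarrow> (\<forall>y. dist x y < s (dist x x0) \<longrightarrow> \<bar>?f x - ?f y\<bar> < \<epsilon>)"
  proof (intro exI[of _ ?r] conjI allI impI)
    show "?r > 0" using t0 by simp
    fix x y assume x: "dist x x0 > ?r" and y: "dist x y < s (dist x x0)"
    have 1: "2 * dist x y < dist x x0" using t0(2)[of "dist x x0"] x y by simp
    have 2: "dist x x0 \<le> dist x y + dist a y + dist a x0"
      using dist_triangle[of x x0 y] dist_triangle[of y x0 a] dist_commute[of y a] by linarith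
    have 3: "dist x x0 \<le> dist a x + dist a x0" 
      using dist_triangle[of x x0 a] dist_commute[of x a] by linarith
    have 4: "2 * (r + dist a x0) < dist x x0" "0 \<le> dist a x0" using x by simp_all
    have "r - dist a x \<le> 0" using 3 4 assms by (smt (verit))
    moreover have "r - dist a y \<le> 0" using 1 2 4 assms by (smt (verit))
    ultimately have "?f x = 0" "?f y = 0" by simp_all
    then show "\<bar>?f x - ?f y\<bar> < \<epsilon>" using e by simp
  qed
qed

context
  fixes x0 :: "'a::metric_space"
begin

private abbreviation "C \<equiv> sublinear_Higson_functions x0"
private abbreviation "P \<equiv> product_topology (\<lambda>_. euclideanreal) C"
private abbreviation "e \<equiv> sublinear_Higson_embedding x0"
private abbreviation "H \<equiv> sublinear_Higson_compactification x0"

lemma sublinear_Higson_embedding_apply: "f \<in> C \<Longrightarrow> e x f = f x"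
  by (simp add: sublinear_Higson_embedding_def)

private lemma H_eq: "H = subtopology P (P closure_of range e)"
  by (simp add: sublinear_Higson_compactification_def Let_def)

private lemma range_e: "range e \<subseteq> topspace P"
  by (auto simp: sublinear_Higson_embedding_def)

private lemma topspace_H: "topspace H = P closure_of range e"
  unfolding H_eq by (rule topspace_subtopology_subset[OF closure_of_subset_topspace])

private lemma range_e_H: "range e \<subseteq> topspace H"
  unfolding topspace_H by (rule closure_of_subset[OF range_e])

private lemma coord: "f \<in> C \<Longrightarrow> continuous_map H euclideanreal (\<lambda>p. p f)"
  unfolding H_eq
  by (intro continuous_map_from_subtopology continuous_map_product_coordinates)

lemma Hausdorff_sublinear_Higson_compactification: "Hausdorff_space H"
  unfolding H_eq by (intro Hausdorff_space_subtopology) (simp add: Hausdorff_space_product_topology)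

lemma compact_sublinear_Higson_compactification: "compact_space H"
proof -
  let ?Q = "PiE C (\<lambda>f. closure (range f))"
  have "compactin P ?Q"
    unfolding compactin_PiE by (auto simp: sublinear_Higson_functions_def)
  moreover have "closedin P ?Q" by (simp add: closedin_product_topology)
  moreover have "range e \<subseteq> ?Q"
    by (auto simp: sublinear_Higson_embedding_def intro: subsetD[OF closure_subset])
  ultimately have "compactin P (P closure_of range e)"
    by (meson closed_compactin closedin_closure_of closure_of_minimal)
  then show ?thesis unfolding H_eq by (rule compact_space_subtopology)
qed

lemma dense_sublinear_Higson_embedding: "H closure_of range e = topspace H"
  unfolding topspace_H unfolding H_eq closure_of_subtopology
  using closure_of_subset[OF range_e] by (simp add: inf_absorb2)

lemma embedding_map_sublinear_Higson_embedding: "embedding_map euclidean H e"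
proof -
  let ?b = "\<lambda>a r x. max 0 (r - dist a x)"
  have bump: "e x (?b a r) = ?b a r x" "?b a r \<in> C" if "r > 0" for r a x
    using sublinear_Higson_functions_bump[OF that, of a x0]
    by (simp_all add: sublinear_Higson_embedding_apply)
  have inj: "inj e"
  proof (rule injI, rule ccontr)
    fix x y assume "e x = e y" "x \<noteq> y"
    then show False using bump(1)[of "dist x y" x x] bump(1)[of "dist x y" y x] by simp
  qed
  have cont: "continuous_map euclidean P e"
  proof (rule continuous_map_coordinatewise_then_product)
    fix f assume "f \<in> C"
    then show "continuous_map euclidean euclideanreal (\<lambda>x. e x f)"
      by (simp add: sublinear_Higson_embedding_apply) (simp add: sublinear_Higson_functions_def)
  qed (simp add: sublinear_Higson_embedding_def)
  have contH: "continuous_map euclidean H e"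
    unfolding H_eq using cont closure_of_subset[OF range_e]
    by (auto simp: continuous_map_in_subtopology)
  have "open_map euclidean (subtopology H (range e)) e"
    unfolding open_map_def
  proof (intro allI impI)
    fix U :: "'a set" assume "openin euclidean U"
    then have "open U" by simp
    show "openin (subtopology H (range e)) (e ` U)"
    proof (subst openin_subopen, intro ballI)
      fix p assume "p \<in> e ` U"
      then obtain a where a: "a \<in> U" "p = e a" by auto
      obtain r where r: "r > 0" "ball a r \<subseteq> U" using \<open>open U\<close> a open_contains_ball by blast
      let ?T = "{p \<in> topspace H. p (?b a r) \<in> {0<..}}"
      have "openin H ?T"
        by (rule openin_continuous_map_preimage[OF coord[OF bump(2)[OF r(1)]]]) simp
      then have "openin (subtopology H (range e)) (range e \<inter> ?T)"
        by (rule openin_subtopology_Int2)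
      moreover have "p \<in> range e \<inter> ?T"
        using bump(1)[OF r(1), of a a] a r range_e_H by auto
      moreover have "range e \<inter> ?T \<subseteq> e ` U"
      proof
        fix q assume "q \<in> range e \<inter> ?T"
        then obtain x where x: "q = e x" "e x (?b a r) > 0" by auto
        then have "x \<in> ball a r" using bump(1)[OF r(1), of x a] by auto
        then show "q \<in> e ` U" using r x by auto
      qed
      ultimately show "\<exists>T. openin (subtopology H (range e)) T \<and> p \<in> T \<and> T \<subseteq> e ` U" by blast
    qed
  qed
  moreover have "continuous_map euclidean (subtopology H (range e)) e"
    using contH by (simp add: continuous_map_in_subtopology)
  ultimately have "homeomorphic_map euclidean (subtopology H (range e)) e"
    using inj range_e_H
    by (intro bijective_open_imp_homeomorphic_map) (auto simp: topspace_subtopology_subset)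
  then show ?thesis by (simp add: embedding_map_def)
qed

text \<open>By compactness, a continuous function on the compactification is controlled up to any
  given error by finitely many coordinates.\<close>

private lemma finitely_many_coordinates:
  assumes F: "continuous_map H euclideanreal F" and \<epsilon>: "\<epsilon> > 0"
  shows "\<exists>G \<delta>. finite G \<and> G \<subseteq> C \<and> \<delta> > 0 \<and>
           (\<forall>p\<in>topspace H. \<forall>q\<in>topspace H. (\<forall>g\<in>G. \<bar>p g - q g\<bar> < \<delta>) \<longrightarrow> \<bar>F p - F q\<bar> < \<epsilon>)"
proof -
  have "\<exists>G \<delta>. finite G \<and> G \<subseteq> C \<and> \<delta> > 0 \<and>
          (\<forall>q\<in>topspace H. (\<forall>g\<in>G. \<bar>q g - p g\<bar> < 2 * \<delta>) \<longrightarrow> \<bar>F q - F p\<bar> < \<epsilon> / 2)"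
    if p: "p \<in> topspace H" for p
  proof -
    define U where "U = {q \<in> topspace H. F q \<in> ball (F p) (\<epsilon> / 2)}"
    have "openin H U" unfolding U_def by (rule openin_continuous_map_preimage[OF F]) simp
    then obtain V where V: "openin P V" "U = V \<inter> P closure_of range e"
      unfolding H_eq openin_subtopology by blast
    have "p \<in> U" using p \<epsilon> by (simp add: U_def)
    then have "p \<in> V" using V(2) by blast
    then obtain W where W: "finite {i \<in> C. W i \<noteq> UNIV}" "\<And>i. i \<in> C \<Longrightarrow> open (W i)"
      "p \<in> PiE C W" "PiE C W \<subseteq> V"
    proof -
      have "\<exists>W. finite {i \<in> C. W i \<noteq> topspace euclideanreal} \<and>
              (\<forall>i\<in>C. openin euclideanreal (W i)) \<and> p \<in> PiE C W \<and> PiE C W \<subseteq> V"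
        using V(1)[unfolded openin_product_topology_alt] \<open>p \<in> V\<close> by (rule bspec)
      then show thesis using that unfolding topspace_euclidean open_openin[symmetric] by blast
    qed
    let ?G = "{i \<in> C. W i \<noteq> UNIV}"
    have "\<exists>d>0. ball (p i) d \<subseteq> W i" if "i \<in> ?G" for i
    proof -
      have "open (W i)" "p i \<in> W i" using W(2)[of i] PiE_mem[OF W(3), of i] that by auto
      then show ?thesis by (rule openE) blast
    qed
    then have "\<exists>d. \<forall>i\<in>?G. d i > 0 \<and> ball (p i) (d i) \<subseteq> W i"
      by (intro bchoice) blast
    then obtain d where d: "\<And>i. i \<in> ?G \<Longrightarrow> d i > 0" "\<And>i. i \<in> ?G \<Longrightarrow> ball (p i) (d i) \<subseteq> W i"
      by blast
    define \<delta> where "\<delta> = Min (insert 1 (d ` ?G)) / 2"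
    have \<delta>: "\<delta> > 0" "\<And>i. i \<in> ?G \<Longrightarrow> 2 * \<delta> \<le> d i"
      using W(1) d(1) unfolding \<delta>_def by auto
    have "\<bar>F q - F p\<bar> < \<epsilon> / 2" if q: "q \<in> topspace H" "\<forall>g\<in>?G. \<bar>q g - p g\<bar> < 2 * \<delta>" for q
    proof -
      have "q i \<in> W i" if i: "i \<in> C" for i
      proof (cases "i \<in> ?G")
        case True
        then have "q i \<in> ball (p i) (d i)"
          using q(2) \<delta>(2)[OF True] by (force simp: dist_real_def)
        then show ?thesis using d(2)[OF True] by blast
      qed (use i in auto)
      moreover have "q \<in> extensional C"
        using q(1) unfolding topspace_H using closure_of_subset_topspace[of P "range e"]
        by (auto simp: PiE_def)
      ultimately have "q \<in> PiE C W" by (simp add: PiE_iff)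
      then have "q \<in> V" using W(4) by blast
      then have "q \<in> U" using V(2) q(1) unfolding topspace_H by blast
      then show ?thesis by (simp add: U_def dist_real_def abs_minus_commute)
    qed
    then show ?thesis using W(1) \<delta>(1) by (intro exI[of _ ?G] exI[of _ \<delta>]) auto
  qed
  then have "\<forall>p\<in>topspace H. \<exists>Gd. finite (fst Gd) \<and> fst Gd \<subseteq> C \<and> snd Gd > 0 \<and>
      (\<forall>q\<in>topspace H. (\<forall>g\<in>fst Gd. \<bar>q g - p g\<bar> < 2 * snd Gd) \<longrightarrow> \<bar>F q - F p\<bar> < \<epsilon> / 2)"
    by simp
  from bchoice[OF this] obtain Gd where Gd: "\<forall>p\<in>topspace H. finite (fst (Gd p)) \<and> fst (Gd p) \<subseteq> C
      \<and> snd (Gd p) > 0 \<and> (\<forall>q\<in>topspace H. (\<forall>g\<in>fst (Gd p). \<bar>q g - p g\<bar> < 2 * snd (Gd p))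
        \<longrightarrow> \<bar>F q - F p\<bar> < \<epsilon> / 2)" ..
  define G \<delta> where "G p = fst (Gd p)" and "\<delta> p = snd (Gd p)" for p
  have G: "\<And>p. p \<in> topspace H \<Longrightarrow> finite (G p)" "\<And>p. p \<in> topspace H \<Longrightarrow> G p \<subseteq> C"
      "\<And>p. p \<in> topspace H \<Longrightarrow> \<delta> p > 0"
    and GF: "\<And>p q. p \<in> topspace H \<Longrightarrow> q \<in> topspace H \<Longrightarrow> (\<forall>g\<in>G p. \<bar>q g - p g\<bar> < 2 * \<delta> p)
        \<Longrightarrow> \<bar>F q - F p\<bar> < \<epsilon> / 2"
    using Gd unfolding G_def \<delta>_def by blast+
  define N where "N p = topspace H \<inter> (\<Inter>g\<in>G p. {q \<in> topspace H. q g \<in> ball (p g) (\<delta> p)})" for p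
  have N: "openin H (N p)" if p: "p \<in> topspace H" for p
  proof (cases "G p = {}")
    case False
    have "openin H (\<Inter>g\<in>G p. {q \<in> topspace H. q g \<in> ball (p g) (\<delta> p)})"
      using G[OF p] False
      by (intro openin_INT2 openin_continuous_map_preimage[OF coord]) auto
    then show ?thesis unfolding N_def by (intro openin_Int) auto
  qed (simp add: N_def)
  have "p \<in> N p" if "p \<in> topspace H" for p using G(3)[OF that] that by (simp add: N_def)
  then have "\<exists>\<F>. finite \<F> \<and> \<F> \<subseteq> N ` topspace H \<and> topspace H \<subseteq> \<Union>\<F>"
    using N compact_sublinear_Higson_compactification[unfolded compact_space_alt, rule_format,
        of "N ` topspace H"]
    by blast
  then obtain S where S: "finite S" "S \<subseteq> topspace H" "topspace H \<subseteq> (\<Union>p\<in>S. N p)"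
    by (metis finite_subset_image)
  define D where "D = Min (insert 1 (\<delta> ` S))"
  have D: "D > 0" "\<And>p. p \<in> S \<Longrightarrow> D \<le> \<delta> p"
    using S G(3) unfolding D_def by auto
  have "\<bar>F p - F q\<bar> < \<epsilon>"
    if pq: "p \<in> topspace H" "q \<in> topspace H" "\<forall>g\<in>(\<Union>p\<in>S. G p). \<bar>p g - q g\<bar> < D" for p q
  proof -
    obtain c where c: "c \<in> S" "p \<in> N c" using S(3) pq(1) by blast
    have cH: "c \<in> topspace H" using c S by blast
    have pc: "\<bar>p g - c g\<bar> < \<delta> c" if "g \<in> G c" for g
      using c(2) that by (auto simp: N_def dist_real_def abs_minus_commute)
    have qc: "\<bar>q g - c g\<bar> < 2 * \<delta> c" if "g \<in> G c" for g
    proof -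
      have "\<bar>p g - q g\<bar> < D" using pq(3) c(1) that by blast
      then show ?thesis using pc[OF that] D(2)[OF c(1)] by linarith
    qed
    have "\<bar>F p - F c\<bar> < \<epsilon> / 2" using GF[OF cH pq(1)] pc G(3)[OF cH] by fastforce
    moreover have "\<bar>F q - F c\<bar> < \<epsilon> / 2" using GF[OF cH pq(2)] qc by blast
    ultimately show ?thesis by linarith
  qed
  then show ?thesis
    using S G D(1) by (intro exI[of _ "\<Union>p\<in>S. G p"] exI[of _ D]) blast
qed

theorem sublinear_Higson_compactification_extension_iff:
  assumes "continuous_on UNIV f" "bounded (range f)"
  shows "(\<exists>F. continuous_map H euclideanreal F \<and> (\<forall>x. F (e x) = f x)) \<longleftrightarrow> f \<in> C"
proof
  assume "f \<in> C"
  then show "\<exists>F. continuous_map H euclideanreal F \<and> (\<forall>x. F (e x) = f x)"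
    using coord sublinear_Higson_embedding_apply by blast
next
  assume "\<exists>F. continuous_map H euclideanreal F \<and> (\<forall>x. F (e x) = f x)"
  then obtain F where F: "continuous_map H euclideanreal F" "\<And>x. F (e x) = f x" by blast
  show "f \<in> C"
    unfolding sublinear_Higson_functions_iff
  proof (intro conjI assms ballI allI impI)
    fix s and \<epsilon> :: real assume s: "s \<in> asymptotically_sublinear" and \<epsilon>: "\<epsilon> > 0"
    obtain G \<delta> where G: "finite G" "G \<subseteq> C" and \<delta>: "\<delta> > 0"
      and GF: "\<forall>p\<in>topspace H. \<forall>q\<in>topspace H. (\<forall>g\<in>G. \<bar>p g - q g\<bar> < \<delta>) \<longrightarrow> \<bar>F p - F q\<bar> < \<epsilon>"
      using finitely_many_coordinates[OF F(1) \<epsilon>] by (elim exE conjE)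
    have "\<exists>r>0. \<forall>x. dist x x0 > r \<longrightarrow> (\<forall>y. dist x y < s (dist x x0) \<longrightarrow> \<bar>g x - g y\<bar> < \<delta>)"
      if "g \<in> G" for g
    proof -
      have "g \<in> C" using that G(2) by blast
      from this[unfolded sublinear_Higson_functions_iff, THEN conjunct2, THEN conjunct2, rule_format, OF s \<delta>]
      show ?thesis by simp
    qed
    then have "\<forall>g\<in>G. \<exists>r. r > 0 \<and>
        (\<forall>x. dist x x0 > r \<longrightarrow> (\<forall>y. dist x y < s (dist x x0) \<longrightarrow> \<bar>g x - g y\<bar> < \<delta>))" by blast
    from bchoice[OF this] obtain r where r': "\<forall>g\<in>G. r g > 0 \<and>
        (\<forall>x. dist x x0 > r g \<longrightarrow> (\<forall>y. dist x y < s (dist x x0) \<longrightarrow> \<bar>g x - g y\<bar> < \<delta>))" ..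
    have r: "r g > 0" "\<And>x y. dist x x0 > r g \<Longrightarrow> dist x y < s (dist x x0) \<Longrightarrow> \<bar>g x - g y\<bar> < \<delta>"
      if "g \<in> G" for g
      using bspec[OF r' that] by simp_all
    define R where "R = Max (insert 1 (r ` G))"
    have R: "R > 0" "\<And>g. g \<in> G \<Longrightarrow> r g \<le> R"
      using G(1) unfolding R_def by (auto simp: Max_gr_iff)
    have "\<bar>f x - f y\<bar> < \<epsilon>" if xy: "dist x x0 > R" "dist x y < s (dist x x0)" for x y
    proof -
      have "\<forall>g\<in>G. \<bar>e x g - e y g\<bar> < \<delta>"
      proof
        fix g assume g: "g \<in> G"
        have "dist x x0 > r g" using R(2)[OF g] xy(1) by linarith
        moreover have "g \<in> C" using g G(2) by blast
        ultimately show "\<bar>e x g - e y g\<bar> < \<delta>"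
          using r(2)[OF g _ xy(2)] by (simp add: sublinear_Higson_embedding_apply)
      qed
      then have "\<bar>F (e x) - F (e y)\<bar> < \<epsilon>" using range_e_H
        by (intro GF[rule_format]) auto
      then show ?thesis by (simp add: F(2))
    qed
    then show "\<exists>r0>0. \<forall>x. dist x x0 > r0 \<longrightarrow> (\<forall>y. dist x y < s (dist x x0) \<longrightarrow> \<bar>f x - f y\<bar> < \<epsilon>)"
      using R(1) by blast
  qed
qed

lemma sublinear_Higson_corona_nonempty:
  assumes "\<not> compact (UNIV :: 'a set)"
  shows "topspace (sublinear_Higson_corona x0) \<noteq> {}"
proof
  assume "topspace (sublinear_Higson_corona x0) = {}"
  then have "topspace H = range e"
    using range_e_H by (auto simp: sublinear_Higson_corona_def)
  then have "homeomorphic_map euclidean H e"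
    using embedding_map_sublinear_Higson_embedding
    by (metis embedding_map_def subtopology_topspace topspace_euclidean)
  then have "compact_space (euclidean :: 'a topology)"
    using compact_sublinear_Higson_compactification
    by (metis homeomorphic_compact_space homeomorphic_map_imp_homeomorphic_space)
  then show False using assms by (simp add: compact_space_def)
qed

end

end

theory Submission
  imports Defs
begin

text \<open>A bounded continuous function belongs to the ring defining the compactification exactly when its oscillation
  over balls of radius \<open>\<delta> \<bar>x\<bar>\<close> becomes small as \<open>\<delta>\<close> shrinks and \<open>x\<close> goes to infinity. So the
  functions \<open>x \<mapsto> (v \<bullet> x) / \<bar>x\<bar>\<close> (suitably modified near the origin) extend to the corona, and
  their values at a corona point \<open>p\<close> are \<open>v \<bullet> \<theta>\<close> for a unit vector \<open>\<theta>\<close>: every corona point has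
  a direction. Moreover the slow variation forces \<open>p f = p F\<close> where
  \<open>F x = f (\<bar>x\<bar> \<theta>)\<close>, so that at a point of direction \<open>\<theta>\<close> only the values of \<open>f\<close> along the ray
  through \<open>\<theta>\<close> matter (\<open>corona_value_along_ray\<close>).

  A subset \<open>W\<close> of the space leaves a trace on the corona, the part of its closure lying there. If
  the parts of \<open>W\<close> outside all large balls are connected, the trace is a nested intersection of
  closures of connected sets, hence a continuum (\<open>continuum_corona_trace\<close>). For the whole space,
  of dimension at least two, this shows that the corona is a continuum.

  Now let \<open>p \<noteq> q\<close> be corona points. If their directions differ, two disjoint convex cones around
  the directions have disjoint traces, which are neighborhoods of \<open>p\<close> and \<open>q\<close>. If both have the
  same direction \<open>\<theta>\<close>, choose \<open>f\<close> with \<open>p f < c < d < q f\<close> and a unit vector \<open>w\<close> orthogonal to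
  \<open>\<theta>\<close>. The radii \<open>r\<close> with \<open>f (r \<theta>) \<le> c\<close> and those with \<open>f (r \<theta>) \<ge> d\<close> are kept apart by \<open>F\<close>.
  Two interlocking combs then do the job: the spine of the first is a cone on the side of \<open>w\<close>,
  the spine of the second one on the side of \<open>-w\<close>, and the teeth are spherical pieces that reach
  across the direction \<open>\<theta>\<close> at the radii of the first and of the second kind. Each comb is
  connected arbitrarily far out through its spine (\<open>connected_comb_tail\<close>), and a corona point in
  both traces would have contradictory values of \<open>F\<close> or of the direction functions.\<close>

section \<open>Nested continua\<close>

text \<open>A separation of the intersection extends to disjoint open sets by normality; by compactness
  these already cover, and hence separate, some member of the sequence.\<close>

lemma closedin_connectedin_nest:
  fixes C :: "nat \<Rightarrow> 'a set"
  assumes "compact_space X" "Hausdorff_space X"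
    and clo: "\<And>n. closedin X (C n)" and conn: "\<And>n. connectedin X (C n)" and dec: "decseq C"
  shows "connectedin X (\<Inter>n. C n)"
proof -
  define S where "S = (\<Inter>n. C n)"
  have cl: "closedin X S" unfolding S_def using clo by blast
  have S_sub: "S \<subseteq> C n" for n unfolding S_def by blast
  have False
    if E: "closedin X E1" "closedin X E2" "E1 \<inter> E2 \<inter> S = {}" "S \<subseteq> E1 \<union> E2" "E1 \<inter> S \<noteq> {}" "E2 \<inter> S \<noteq> {}"
    for E1 E2
  proof -
    have "normal_space X"
      using assms compact_Hausdorff_or_regular_imp_normal_space by blast
    moreover have "closedin X (E1 \<inter> S)" "closedin X (E2 \<inter> S)" using E cl by (simp_all add: closedin_Int)
    moreover have "disjnt (E1 \<inter> S) (E2 \<inter> S)" using E(3) by (auto simp: disjnt_def)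
    ultimately obtain U V where UV: "openin X U" "openin X V" "E1 \<inter> S \<subseteq> U" "E2 \<inter> S \<subseteq> V" "disjnt U V"
      unfolding normal_space_def by meson
    have "\<exists>n. C n - (U \<union> V) = {}"
    proof (rule ccontr)
      assume "\<nexists>n. C n - (U \<union> V) = {}"
      moreover have "decseq (\<lambda>n. C n - (U \<union> V))" using dec unfolding decseq_def by blast
      moreover have "closedin X (C n - (U \<union> V))" for n using clo UV by blast
      ultimately have "(\<Inter>n. C n - (U \<union> V)) \<noteq> {}"
        by (intro compact_space_imp_nest[OF assms(1)]) auto
      then have "S - (U \<union> V) \<noteq> {}" unfolding S_def by auto
      then show False using E(4) UV(3,4) by blast
    qed
    then obtain n where "C n \<subseteq> U \<union> V" by auto
    moreover have "U \<inter> C n \<noteq> {}" "V \<inter> C n \<noteq> {}" using E(5,6) UV(3,4) S_sub[of n] by blast+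
    moreover have "U \<inter> V \<inter> C n = {}" using UV(5) by (auto simp: disjnt_def)
    ultimately show False using connectedinD[OF conn UV(1,2)] by blast
  qed
  then have "connectedin X S"
    unfolding connectedin_closedin using closedin_subset[OF cl] by blast
  then show ?thesis unfolding S_def .
qed

section \<open>Slow variation of the functions that extend\<close>

lemma continuous_map_sublinear_Higson_coordinate:
  "f \<in> sublinear_Higson_functions x0 \<Longrightarrow>
     continuous_map (sublinear_Higson_compactification x0) euclideanreal (\<lambda>p. p f)"
  unfolding sublinear_Higson_compactification_def Let_def
  by (intro continuous_map_from_subtopology continuous_map_product_coordinates)

text \<open>All asymptotically sublinear functions can be replaced by the linear functions of small slope.
  If no slope worked for \<open>\<epsilon>\<close>, there would be pairs \<open>x\<^sub>n\<close>, \<open>y\<^sub>n\<close> with \<open>x\<^sub>n\<close> tending to infinity,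
  \<open>dist x\<^sub>n y\<^sub>n < \<bar>x\<^sub>n\<bar> / (n + 1)\<close> and values of \<open>f\<close> at distance \<open>\<epsilon>\<close> at least; a single
  sublinear function with the value \<open>\<bar>x\<^sub>n\<bar> / (n + 1)\<close> at \<open>\<bar>x\<^sub>n\<bar>\<close> contradicts this.\<close>

lemma sublinear_Higson_functions_slowly_varying:
  fixes x0 :: "'a::metric_space"
  assumes f: "f \<in> sublinear_Higson_functions x0" and "\<epsilon> > 0"
  shows "\<exists>\<delta>>0. \<exists>R>0. \<forall>x y. dist x x0 > R \<longrightarrow> dist x y < \<delta> * dist x x0 \<longrightarrow> \<bar>f x - f y\<bar> < \<epsilon>"
proof (rule ccontr)
  assume neg: "\<not> ?thesis"
  have bad: "\<exists>x y. dist x x0 > R \<and> dist x y < \<delta> * dist x x0 \<and> \<bar>f x - f y\<bar> \<ge> \<epsilon>"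
    if "\<delta> > 0" for \<delta> R
  proof -
    have "max 1 R > 0" by simp
    with neg that obtain x y where "dist x x0 > max 1 R" "dist x y < \<delta> * dist x x0" "\<not> \<bar>f x - f y\<bar> < \<epsilon>"
      by blast
    then show ?thesis by (intro exI[of _ x] exI[of _ y]) auto
  qed
  have "\<exists>h :: nat \<Rightarrow> 'a \<times> 'a. \<forall>n.
      (dist (fst (h n)) x0 > 0 \<and> dist (fst (h n)) (snd (h n)) < 1 / real (n + 1) * dist (fst (h n)) x0 \<and>
        \<bar>f (fst (h n)) - f (snd (h n))\<bar> \<ge> \<epsilon>) \<and>
      dist (fst (h (Suc n))) x0 > dist (fst (h n)) x0 + 1"
  proof (rule dependent_nat_choice)
    show "\<exists>x. dist (fst x) x0 > 0 \<and> dist (fst x) (snd x) < 1 / real (0 + 1) * dist (fst x) x0 \<and>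
        \<bar>f (fst x) - f (snd x)\<bar> \<ge> \<epsilon>"
      using bad[of 1 0] by simp
    fix h :: "'a \<times> 'a" and n :: nat
    obtain x y where "dist x x0 > max 0 (dist (fst h) x0 + 1)"
      "dist x y < 1 / real (Suc n + 1) * dist x x0" "\<bar>f x - f y\<bar> \<ge> \<epsilon>"
      using bad[of "1 / real (Suc n + 1)" "max 0 (dist (fst h) x0 + 1)"] by auto
    then show "\<exists>y. (dist (fst y) x0 > 0 \<and> dist (fst y) (snd y) < 1 / real (Suc n + 1) * dist (fst y) x0 \<and>
        \<bar>f (fst y) - f (snd y)\<bar> \<ge> \<epsilon>) \<and> dist (fst y) x0 > dist (fst h) x0 + 1"
      by (intro exI[of _ "(x, y)"]) auto
  qed
  then obtain h :: "nat \<Rightarrow> 'a \<times> 'a" where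
    h: "\<And>n. dist (fst (h n)) x0 > 0"
       "\<And>n. dist (fst (h n)) (snd (h n)) < 1 / real (n + 1) * dist (fst (h n)) x0"
       "\<And>n. \<bar>f (fst (h n)) - f (snd (h n))\<bar> \<ge> \<epsilon>"
       "\<And>n. dist (fst (h (Suc n))) x0 > dist (fst (h n)) x0 + 1"
    by metis
  define t where "t n = dist (fst (h n)) x0" for n
  have t_Suc: "t (Suc n) > t n + 1" for n using h(4) by (simp add: t_def)
  have t_mono: "strict_mono t" using t_Suc by (intro strict_monoI_Suc) (smt (verit))
  have t_ge: "t n > real n" for n
  proof (induction n)
    case 0 then show ?case using h(1)[of 0] by (simp add: t_def)
  next
    case (Suc n) then show ?case using t_Suc[of n] by simp
  qed
  have ex: "\<exists>k. r \<le> t k" for r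
  proof -
    obtain k where "r < real k" using reals_Archimedean2 by blast
    then show ?thesis using t_ge[of k] by (intro exI[of _ k]) simp
  qed
  \<comment> \<open>The index \<open>k r\<close> is unbounded in \<open>r\<close>, which makes \<open>r / (k r + 1)\<close> sublinear, and it
    recovers \<open>n\<close> from the radius \<open>t n\<close> because the radii increase strictly.\<close>
  define k where "k r = (LEAST k. r \<le> t k)" for r
  have k_t: "k (t n) = n" for n
    unfolding k_def using t_mono by (intro Least_equality) (auto simp: strict_mono_less_eq)
  have k_gt: "k r > n" if "r > t n" for r n
  proof -
    have "r \<le> t (k r)" unfolding k_def by (rule LeastI_ex) (rule ex)
    then show ?thesis using that t_mono by (smt (verit) strict_mono_less)
  qed
  define s where "s r = r / real (k r + 1)" for r
  have "s \<in> asymptotically_sublinear"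
    unfolding asymptotically_sublinear_def
  proof (intro CollectI conjI allI impI)
    fix r :: real assume "r > 0" then show "s r > 0" by (simp add: s_def)
  next
    fix \<alpha> :: real assume "\<alpha> > 0"
    then obtain n where n: "1 / real (Suc n) < \<alpha>"
      using nat_approx_posE by blast
    show "\<exists>t0>0. \<forall>r>t0. s r < \<alpha> * r"
    proof (intro exI[of _ "t n"] conjI allI impI)
      show "t n > 0" using h(1) by (simp add: t_def)
      fix r assume r: "r > t n"
      then have "r > 0" using \<open>t n > 0\<close> by simp
      have "1 / real (k r + 1) \<le> 1 / real (Suc n)"
        using k_gt[OF r] by (intro divide_left_mono) auto
      then have "1 / real (k r + 1) < \<alpha>" using n by simp
      then have "1 / real (k r + 1) * r < \<alpha> * r" using \<open>r > 0\<close> by (intro mult_strict_right_mono)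
      then show "s r < \<alpha> * r" by (simp add: s_def)
    qed
  qed
  then obtain r0 where r0: "\<And>x y. dist x x0 > r0 \<Longrightarrow> dist x y < s (dist x x0) \<Longrightarrow> \<bar>f x - f y\<bar> < \<epsilon>"
    using f \<open>\<epsilon> > 0\<close> unfolding sublinear_Higson_functions_iff by metis
  obtain n where n: "r0 < real n" using reals_Archimedean2 by blast
  have "dist (fst (h n)) x0 > r0" using n t_ge[of n] by (simp add: t_def)
  moreover have "dist (fst (h n)) (snd (h n)) < s (dist (fst (h n)) x0)"
    using h(2)[of n] k_t[of n] by (simp add: s_def t_def)
  ultimately show False using r0 h(3)[of n] by (meson not_le)
qed

section \<open>The trace of a set on the corona\<close>

definition corona_trace :: "'a::metric_space \<Rightarrow> 'a set \<Rightarrow> (('a \<Rightarrow> real) \<Rightarrow> real) set" where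
  "corona_trace x0 W = topspace (sublinear_Higson_corona x0) \<inter>
     (sublinear_Higson_compactification x0) closure_of (sublinear_Higson_embedding x0 ` W)"

context
  fixes x0 :: "'a::heine_borel"
begin

private abbreviation "C \<equiv> sublinear_Higson_functions x0"
private abbreviation "e \<equiv> sublinear_Higson_embedding x0"
private abbreviation "H \<equiv> sublinear_Higson_compactification x0"
private abbreviation "Z \<equiv> sublinear_Higson_corona x0"

private lemma continuous_e: "continuous_map euclidean H e"
  using embedding_map_sublinear_Higson_embedding[of x0]
  unfolding embedding_map_def topspace_euclidean
  by (intro continuous_map_into_fulltopology[of euclidean H "range e"] homeomorphic_imp_continuous_map)

lemma topspace_sublinear_Higson_corona: "topspace Z = topspace H - range e"
  by (auto simp: sublinear_Higson_corona_def)

text \<open>The trace only depends on the set near infinity, since the image of a closed ball is compact,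
  hence closed, and misses the corona.\<close>

lemma corona_trace_tail:
  "corona_trace x0 (W \<inter> {x. dist x x0 > r}) = corona_trace x0 W"
proof
  show "corona_trace x0 (W \<inter> {x. dist x x0 > r}) \<subseteq> corona_trace x0 W"
    unfolding corona_trace_def by (intro Int_mono order_refl closure_of_mono) auto
  have "compactin H (e ` cball x0 r)"
    by (intro image_compactin[OF _ continuous_e]) simp
  then have cl: "closedin H (e ` cball x0 r)"
    by (rule compactin_imp_closedin[OF Hausdorff_sublinear_Higson_compactification])
  have "H closure_of (e ` W) \<subseteq> H closure_of (e ` (W \<inter> {x. dist x x0 > r}) \<union> e ` cball x0 r)"
    by (intro closure_of_mono) (force simp: dist_commute not_less)
  also have "\<dots> = H closure_of (e ` (W \<inter> {x. dist x x0 > r})) \<union> e ` cball x0 r"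
    by (simp add: closure_of_Un closure_of_closedin cl)
  finally show "corona_trace x0 W \<subseteq> corona_trace x0 (W \<inter> {x. dist x x0 > r})"
    unfolding corona_trace_def topspace_sublinear_Higson_corona by auto
qed

lemma corona_trace_UNIV: "corona_trace x0 UNIV = topspace Z"
  unfolding corona_trace_def dense_sublinear_Higson_embedding topspace_sublinear_Higson_corona
  by auto

text \<open>Non-strict inequalities between continuous functions that hold on \<open>W\<close> near infinity persist on
  the trace. All facts about corona points below are obtained in this way.\<close>

lemma corona_trace_le_0:
  assumes z: "z \<in> corona_trace x0 W" and G: "continuous_map H euclideanreal G"
    and le: "\<And>x. x \<in> W \<Longrightarrow> dist x x0 > r \<Longrightarrow> G (e x) \<le> 0"
  shows "G z \<le> 0"
proof -
  have "z \<in> H closure_of (e ` (W \<inter> {x. dist x x0 > r}))"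
    using z unfolding corona_trace_tail[of W r, symmetric] by (simp add: corona_trace_def)
  moreover have "closedin H {z \<in> topspace H. G z \<in> {..0}}"
    by (rule closedin_continuous_map_preimage[OF G]) simp
  ultimately show ?thesis
    using le by (auto intro: forall_in_closure_of[where P = "\<lambda>z. G z \<le> 0"])
qed

text \<open>The closures of the tails of \<open>W\<close> eventually avoid each point of the space itself, because the
  bump function of radius \<open>n\<close> at the base point vanishes on the \<open>n\<close>-th tail.\<close>

lemma corona_trace_eq_nest:
  "corona_trace x0 W = (\<Inter>n. H closure_of (e ` (W \<inter> {x. dist x x0 > real n})))" (is "_ = (\<Inter>n. ?K n)")
proof
  have "corona_trace x0 W \<subseteq> ?K n" for n
    using corona_trace_tail[of W "real n"] unfolding corona_trace_def by blast
  then show "corona_trace x0 W \<subseteq> (\<Inter>n. ?K n)" by blast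
  have "e x \<notin> (\<Inter>n. ?K n)" for x
  proof
    assume x: "e x \<in> (\<Inter>n. ?K n)"
    obtain n where n: "dist x0 x < real n" using reals_Archimedean2 by blast
    let ?g = "\<lambda>y. max 0 (real n - dist x0 y)"
    have "0 < real n" using n zero_le_dist[of x0 x] by linarith
    then have g: "?g \<in> C" by (rule sublinear_Higson_functions_bump)
    have "closedin H {z \<in> topspace H. z ?g \<in> {0}}"
      by (rule closedin_continuous_map_preimage[OF continuous_map_sublinear_Higson_coordinate[OF g]]) simp
    then have "e x ?g = 0"
      using x sublinear_Higson_embedding_apply[OF g]
      by (intro forall_in_closure_of[of "e x" H "e ` (W \<inter> {x. dist x x0 > real n})" "\<lambda>z. z ?g = 0"])
         (auto simp: dist_commute)
    then show False using n sublinear_Higson_embedding_apply[OF g, of x] by simp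
  qed
  moreover have "?K 0 \<subseteq> H closure_of (e ` W)" by (intro closure_of_mono) auto
  then have "(\<Inter>n. ?K n) \<subseteq> H closure_of (e ` W)" by blast
  ultimately show "(\<Inter>n. ?K n) \<subseteq> corona_trace x0 W"
    using closure_of_subset_topspace[of H "e ` W"]
    unfolding corona_trace_def topspace_sublinear_Higson_corona by blast
qed

lemma continuum_corona_trace:
  assumes conn: "\<And>n. connected (W \<inter> {x. dist x x0 > real n})"
  shows "continuum (subtopology H (corona_trace x0 W))"
proof -
  let ?K = "\<lambda>n. H closure_of (e ` (W \<inter> {x. dist x x0 > real n}))"
  have "connectedin H (corona_trace x0 W)"
    unfolding corona_trace_eq_nest
  proof (rule closedin_connectedin_nest)
    show "connectedin H (?K n)" for n
      by (intro connectedin_closure_of connectedin_continuous_map_image[OF continuous_e])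
         (use conn in simp)
    show "decseq ?K"
      unfolding decseq_def by (intro allI impI closure_of_mono image_mono) auto
  qed (simp_all add: compact_sublinear_Higson_compactification Hausdorff_sublinear_Higson_compactification)
  moreover have "closedin H (corona_trace x0 W)"
    unfolding corona_trace_eq_nest by (intro closedin_INT) auto
  then have "compactin H (corona_trace x0 W)"
    by (rule closedin_compact_space[OF compact_sublinear_Higson_compactification])
  ultimately show ?thesis
    unfolding continuum_def
    by (simp add: compact_space_subtopology connectedin_def Hausdorff_space_subtopology
        Hausdorff_sublinear_Higson_compactification)
qed

text \<open>An open set of the compactification that meets the space near infinity only inside \<open>W\<close> has its
  corona points in the trace of \<open>W\<close>, because every corona point is a limit of points of the space
  near infinity. This makes the trace a neighborhood.\<close>

lemma continuum_neighborhood_corona_trace: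
  assumes conn: "\<And>n. connected (W \<inter> {x. dist x x0 > real n})"
    and p: "p \<in> topspace Z" "p \<in> N" and N: "openin H N"
    and sub: "\<And>x. dist x x0 > r \<Longrightarrow> e x \<in> N \<Longrightarrow> x \<in> W"
  shows "continuum_neighborhood Z p (corona_trace x0 W)"
proof -
  have sub_Z: "corona_trace x0 W \<subseteq> topspace Z" by (simp add: corona_trace_def)
  have "subtopology Z (corona_trace x0 W) = subtopology H (corona_trace x0 W)"
    using sub_Z unfolding sublinear_Higson_corona_def subtopology_subtopology
    by (simp add: inf_absorb2 topspace_subtopology)
  then have "subcontinuum Z (corona_trace x0 W)"
    using continuum_corona_trace[OF conn] sub_Z by (simp add: subcontinuum_def)
  moreover have "openin Z (N \<inter> topspace Z)"
  proof -
    have "openin Z ((topspace H - range e) \<inter> N)"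
      unfolding sublinear_Higson_corona_def using N by (rule openin_subtopology_Int2)
    then show ?thesis by (simp add: topspace_sublinear_Higson_corona Int_commute)
  qed
  moreover have "N \<inter> topspace Z \<subseteq> corona_trace x0 W"
  proof
    fix z assume z: "z \<in> N \<inter> topspace Z"
    then have "z \<in> corona_trace x0 (UNIV \<inter> {x. dist x x0 > r})"
      unfolding corona_trace_tail corona_trace_UNIV by simp
    then have "z \<in> H closure_of (N \<inter> e ` {x. dist x x0 > r})"
      using openin_Int_closure_of_subset[OF N] z unfolding corona_trace_def by auto
    moreover have "N \<inter> e ` {x. dist x x0 > r} \<subseteq> e ` W" using sub by auto
    ultimately have "z \<in> H closure_of (e ` W)" using closure_of_mono by blast
    then show "z \<in> corona_trace x0 W" using z by (simp add: corona_trace_def)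
  qed
  ultimately show ?thesis
    using p unfolding continuum_neighborhood_def by (auto intro: interior_of_maximal[THEN subsetD])
qed

end


section \<open>Directions of corona points\<close>

lemma sublinear_Higson_functions_if_Lipschitz_bound:
  fixes f :: "'a::metric_space \<Rightarrow> real"
  assumes "continuous_on UNIV f" "bounded (range f)" and "K > 0"
    and lip: "\<And>x y. dist x x0 > 1 \<Longrightarrow> \<bar>f x - f y\<bar> * dist x x0 \<le> K * dist x y"
  shows "f \<in> sublinear_Higson_functions x0"
  unfolding sublinear_Higson_functions_iff
proof (intro conjI ballI allI impI assms)
  fix s and \<epsilon> :: real assume s: "s \<in> asymptotically_sublinear" and "\<epsilon> > 0"
  then have "\<epsilon> / K > 0" using \<open>K > 0\<close> by simp
  then obtain t0 where t0: "\<And>t. t > t0 \<Longrightarrow> s t < \<epsilon> / K * t"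
    using s unfolding asymptotically_sublinear_def by blast
  show "\<exists>r0>0. \<forall>x. dist x x0 > r0 \<longrightarrow> (\<forall>y. dist x y < s (dist x x0) \<longrightarrow> \<bar>f x - f y\<bar> < \<epsilon>)"
  proof (intro exI[of _ "max 1 t0"] conjI allI impI)
    fix x y assume x: "max 1 t0 < dist x x0" and y: "dist x y < s (dist x x0)"
    have "dist x y < \<epsilon> / K * dist x x0" using t0[of "dist x x0"] x y by simp
    then have "K * dist x y < \<epsilon> * dist x x0" using \<open>K > 0\<close> by (simp add: field_simps)
    with lip[of x y] x have "\<bar>f x - f y\<bar> * dist x x0 < \<epsilon> * dist x x0" by simp
    then show "\<bar>f x - f y\<bar> < \<epsilon>" using x by (simp add: mult_less_cancel_right)
  qed simp
qed

text \<open>The maximum in the denominator serves continuity at the origin; away from the unit ball this is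
  the coordinate of \<open>x / \<bar>x\<bar>\<close> along \<open>v\<close>.\<close>

definition direction_coord :: "'a::real_inner \<Rightarrow> 'a \<Rightarrow> real" where
  "direction_coord v x = (v \<bullet> x) / max 1 (norm x)"

lemma abs_max_diff_le: "\<bar>max 1 (norm x) - max 1 (norm y)\<bar> \<le> norm (x - y)"
  for x y :: "'a::real_normed_vector"
  using norm_triangle_ineq3[of x y] by linarith

lemma direction_coord_in_sublinear_Higson_functions:
  "direction_coord v \<in> sublinear_Higson_functions (0 :: 'a::real_inner)"
proof (rule sublinear_Higson_functions_if_Lipschitz_bound)
  show "continuous_on UNIV (direction_coord v)"
    unfolding direction_coord_def by (intro continuous_intros) (auto simp: max_def)
  show "bounded (range (direction_coord v))"
  proof (rule boundedI[of _ "norm v"], clarify)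
    fix x :: 'a
    have "\<bar>v \<bullet> x\<bar> \<le> norm v * norm x" by (rule Cauchy_Schwarz_ineq2)
    also have "\<dots> \<le> norm v * max 1 (norm x)" by (intro mult_left_mono) auto
    finally show "norm (direction_coord v x) \<le> norm v"
      by (simp add: direction_coord_def divide_le_eq)
  qed
  show "2 * norm v + 1 > 0" by (simp add: add_nonneg_pos)
  fix x y :: 'a assume "dist x 0 > 1"
  then have x: "norm x > 1" by simp
  define m where "m = max 1 (norm y)"
  have m: "m > 0" "norm y \<le> m" by (auto simp: m_def)
  \<comment> \<open>Over the common denominator \<open>\<bar>x\<bar> m\<close> the difference of \<open>x / \<bar>x\<bar>\<close> and \<open>y / m\<close> has the
    numerator \<open>m (x - y) + (m - \<bar>x\<bar>) y\<close>, both parts of which are at most \<open>m \<bar>x - y\<bar>\<close>.\<close>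
  have "\<bar>direction_coord v x - direction_coord v y\<bar> * norm x * m = \<bar>v \<bullet> (m *\<^sub>R (x - y) + (m - norm x) *\<^sub>R y)\<bar>"
  proof -
    have "(direction_coord v x - direction_coord v y) * (norm x * m)
        = v \<bullet> (m *\<^sub>R (x - y) + (m - norm x) *\<^sub>R y)"
      using x m by (simp add: direction_coord_def m_def[symmetric] field_simps inner_simps)
    moreover have "\<bar>norm x * m\<bar> = norm x * m" using x m by simp
    ultimately show ?thesis by (metis abs_mult mult.assoc)
  qed
  also have "\<dots> \<le> norm v * norm (m *\<^sub>R (x - y) + (m - norm x) *\<^sub>R y)" by (rule Cauchy_Schwarz_ineq2)
  also have "norm (m *\<^sub>R (x - y) + (m - norm x) *\<^sub>R y) \<le> m * norm (x - y) + \<bar>m - norm x\<bar> * norm y"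
    using m by (intro norm_triangle_le) simp
  also have "\<bar>m - norm x\<bar> * norm y \<le> norm (x - y) * m"
    using abs_max_diff_le[of x y] x m by (intro mult_mono) (auto simp: m_def abs_minus_commute)
  finally have "\<bar>direction_coord v x - direction_coord v y\<bar> * norm x * m
      \<le> norm v * (m * norm (x - y) + norm (x - y) * m)"
    by (simp add: mult_left_mono)
  also have "\<dots> = (2 * norm v * norm (x - y)) * m" by (simp add: algebra_simps)
  finally have "\<bar>direction_coord v x - direction_coord v y\<bar> * norm x * m \<le> (2 * norm v * norm (x - y)) * m" .
  then have "\<bar>direction_coord v x - direction_coord v y\<bar> * norm x \<le> 2 * norm v * norm (x - y)"
    using m by (simp add: mult_le_cancel_right)
  also have "\<dots> \<le> (2 * norm v + 1) * norm (x - y)" by (intro mult_right_mono) auto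
  finally show "\<bar>direction_coord v x - direction_coord v y\<bar> * dist x 0 \<le> (2 * norm v + 1) * dist x y"
    by (simp add: dist_norm)
qed

lemma direction_coord_eq: "norm x > 1 \<Longrightarrow> direction_coord v x = (v \<bullet> x) / norm x"
  by (simp add: direction_coord_def max_def)

text \<open>Rolling the space up onto a ray preserves norms and does not increase distances.\<close>

lemma sublinear_Higson_functions_along_ray:
  fixes \<theta> :: "'a::real_inner"
  assumes f: "f \<in> sublinear_Higson_functions (0 :: 'a)" and \<theta>: "norm \<theta> = 1"
  shows "(\<lambda>x. f (norm x *\<^sub>R \<theta>)) \<in> sublinear_Higson_functions (0 :: 'a)"
  unfolding sublinear_Higson_functions_iff
proof (intro conjI ballI allI impI)
  have cont: "continuous_on UNIV f" and bdd: "bounded (range f)"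
    using f by (auto simp: sublinear_Higson_functions_def)
  show "continuous_on UNIV (\<lambda>x::'a. f (norm x *\<^sub>R \<theta>))"
    by (rule continuous_on_compose2[OF cont]) (auto intro!: continuous_intros)
  show "bounded (range (\<lambda>x::'a. f (norm x *\<^sub>R \<theta>)))" by (rule bounded_subset[OF bdd]) auto
  fix s and \<epsilon> :: real assume "s \<in> asymptotically_sublinear" "\<epsilon> > 0"
  then obtain r0 where r0: "r0 > 0"
    "\<And>x y. dist x 0 > r0 \<Longrightarrow> dist x y < s (dist x 0) \<Longrightarrow> \<bar>f x - f y\<bar> < \<epsilon>"
    using f unfolding sublinear_Higson_functions_iff by metis
  show "\<exists>r0>0. \<forall>x::'a. dist x 0 > r0 \<longrightarrow>
      (\<forall>y. dist x y < s (dist x 0) \<longrightarrow> \<bar>f (norm x *\<^sub>R \<theta>) - f (norm y *\<^sub>R \<theta>)\<bar> < \<epsilon>)"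
  proof (intro exI[of _ r0] conjI allI impI r0)
    fix x y :: 'a assume x: "r0 < dist x 0" and y: "dist x y < s (dist x 0)"
    show "dist (norm x *\<^sub>R \<theta>) 0 > r0" using x \<theta> by simp
    have "dist (norm x *\<^sub>R \<theta>) (norm y *\<^sub>R \<theta>) = \<bar>norm x - norm y\<bar>"
      by (simp add: dist_norm \<theta> flip: scaleR_diff_left)
    also have "\<dots> \<le> dist x y" unfolding dist_norm by (rule norm_triangle_ineq3)
    finally show "dist (norm x *\<^sub>R \<theta>) (norm y *\<^sub>R \<theta>) < s (dist (norm x *\<^sub>R \<theta>) 0)"
      using y \<theta> by simp
  qed
qed

text \<open>Mutual aposyndesis for a single pair of points, as a relation whose symmetry allows \<open>p\<close> and \<open>q\<close>
  to be exchanged.\<close>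

definition disjoint_continuum_neighborhoods :: "'a topology \<Rightarrow> 'a \<Rightarrow> 'a \<Rightarrow> bool" where
  "disjoint_continuum_neighborhoods Z p q \<longleftrightarrow>
     (\<exists>U V. continuum_neighborhood Z p U \<and> continuum_neighborhood Z q V \<and> U \<inter> V = {})"

context
begin

private abbreviation "C\<^sub>0 \<equiv> sublinear_Higson_functions (0::'a::euclidean_space)"
private abbreviation "e\<^sub>0 \<equiv> sublinear_Higson_embedding (0::'a::euclidean_space)"
private abbreviation "H\<^sub>0 \<equiv> sublinear_Higson_compactification (0::'a::euclidean_space)"
private abbreviation "Z\<^sub>0 \<equiv> sublinear_Higson_corona (0::'a::euclidean_space)"

private lemma coord_dir: "continuous_map H\<^sub>0 euclideanreal (\<lambda>z. z (direction_coord v))"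
  by (intro continuous_map_sublinear_Higson_coordinate direction_coord_in_sublinear_Higson_functions)

private lemma coord_apply: "e\<^sub>0 x (direction_coord v) = direction_coord v x"
  by (intro sublinear_Higson_embedding_apply direction_coord_in_sublinear_Higson_functions)

private lemma corona_eq_0:
  fixes G :: "(('a::euclidean_space \<Rightarrow> real) \<Rightarrow> real) \<Rightarrow> real"
  assumes z: "z \<in> topspace Z\<^sub>0" and G: "continuous_map H\<^sub>0 euclideanreal G"
    and eq: "\<And>x. norm x > 1 \<Longrightarrow> G (e\<^sub>0 x) = 0"
  shows "G z = 0"
proof -
  have z: "z \<in> corona_trace 0 UNIV" using z by (simp add: corona_trace_UNIV)
  have "G z \<le> 0" by (rule corona_trace_le_0[OF z G, of 1]) (simp add: eq)
  moreover have "- G z \<le> 0"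
    by (rule corona_trace_le_0[OF z continuous_map_minus[OF G], of 1]) (simp add: eq)
  ultimately show ?thesis by simp
qed

text \<open>The value at \<open>z\<close> of the direction coordinate is linear in \<open>v\<close>, and the coordinates along an
  orthonormal basis have squares summing to one: both hold in the space outside the unit ball, and
  pass to the limit.\<close>

lemma corona_point_has_direction:
  assumes z: "z \<in> topspace (sublinear_Higson_corona (0::'a::euclidean_space))"
  shows "\<exists>\<theta>::'a. norm \<theta> = 1 \<and> (\<forall>v. z (direction_coord v) = v \<bullet> \<theta>)"
proof -
  define \<theta> :: 'a where "\<theta> = (\<Sum>b\<in>Basis. z (direction_coord b) *\<^sub>R b)"
  have lin: "z (direction_coord v) = v \<bullet> \<theta>" for v :: 'a
  proof -
    have "z (direction_coord v) - (\<Sum>b\<in>Basis. (v \<bullet> b) * z (direction_coord b)) = 0"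
    proof (rule corona_eq_0[OF z])
      show "continuous_map H\<^sub>0 euclideanreal
          (\<lambda>z. z (direction_coord v) - (\<Sum>b\<in>Basis. (v \<bullet> b) * z (direction_coord b)))"
        by (intro continuous_intros coord_dir) auto
      show "e\<^sub>0 x (direction_coord v) - (\<Sum>b\<in>Basis. (v \<bullet> b) * e\<^sub>0 x (direction_coord b)) = 0" for x :: 'a
        unfolding coord_apply direction_coord_def
        by (simp add: euclidean_inner[of v x] sum_divide_distrib inner_commute)
    qed
    then show ?thesis by (simp add: \<theta>_def inner_sum_right mult.commute)
  qed
  have "(\<Sum>b\<in>Basis. z (direction_coord (b::'a)) ^ 2) - 1 = 0"
  proof (rule corona_eq_0[OF z])
    show "continuous_map H\<^sub>0 euclideanreal (\<lambda>z. (\<Sum>b\<in>Basis. z (direction_coord (b::'a)) ^ 2) - 1)"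
      by (intro continuous_intros coord_dir) auto
    fix x :: 'a assume x: "norm x > 1"
    have "(\<Sum>b\<in>Basis. (b \<bullet> x)\<^sup>2) = (norm x)\<^sup>2"
      unfolding power2_norm_eq_inner euclidean_inner[of x x] by (simp add: power2_eq_square inner_commute)
    then show "(\<Sum>b\<in>Basis. e\<^sub>0 x (direction_coord (b::'a)) ^ 2) - 1 = 0"
      unfolding coord_apply direction_coord_eq[OF x] power_divide sum_divide_distrib[symmetric]
      using x by (cases "x = 0") simp_all
  qed
  moreover have "(norm \<theta>)\<^sup>2 = (\<Sum>b\<in>Basis. (b \<bullet> \<theta>)\<^sup>2)"
    unfolding power2_norm_eq_inner euclidean_inner[of \<theta> \<theta>] by (simp add: power2_eq_square inner_commute)
  ultimately have "(norm \<theta>)\<^sup>2 = 1" by (simp add: lin)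
  then have "norm \<theta> = 1" by (simp add: power2_eq_1_iff) (smt (verit) norm_ge_zero)
  then show ?thesis using lin by blast
qed

text \<open>Near \<open>z\<close> the direction of \<open>x\<close> is close to \<open>\<theta>\<close>, so \<open>x\<close> lies within a small multiple of
  \<open>\<bar>x\<bar>\<close> of the point \<open>\<bar>x\<bar> \<theta>\<close>, and slow variation applies to these two points.\<close>

lemma corona_value_along_ray:
  fixes \<theta> :: "'a::euclidean_space"
  assumes z: "z \<in> topspace (sublinear_Higson_corona (0::'a))"
    and \<theta>: "norm \<theta> = 1" "\<And>v. z (direction_coord v) = v \<bullet> \<theta>"
    and f: "f \<in> sublinear_Higson_functions (0::'a)"
  shows "z (\<lambda>x. f (norm x *\<^sub>R \<theta>)) = z f"
proof -
  define F where "F x = f (norm x *\<^sub>R \<theta>)" for x :: 'a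
  have F: "F \<in> C\<^sub>0" unfolding F_def by (rule sublinear_Higson_functions_along_ray[OF f \<theta>(1)])
  have "\<bar>z F - z f\<bar> \<le> \<epsilon>" if pos: "\<epsilon> > 0" for \<epsilon>
  proof -
    obtain \<delta> R where \<delta>: "\<delta> > 0" "R > 0"
      and near: "\<And>x y. norm x > R \<Longrightarrow> dist x y < \<delta> * norm x \<Longrightarrow> \<bar>f x - f y\<bar> < \<epsilon>"
      using sublinear_Higson_functions_slowly_varying[OF f pos] by auto
    \<comment> \<open>That \<open>?G\<close> is nonpositive says: if the direction coordinate along \<open>\<theta>\<close> exceeds
      \<open>1 - \<delta>\<^sup>2 / 2\<close>, then \<open>F\<close> and \<open>f\<close> differ by at most \<open>\<epsilon>\<close>. The constant comes from
      \<open>\<bar>x - \<bar>x\<bar> \<theta>\<bar>\<^sup>2 = 2 \<bar>x\<bar>\<^sup>2 (1 - \<theta> \<bullet> x / \<bar>x\<bar>)\<close>.\<close>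
    let ?G = "\<lambda>z. min (\<bar>z F - z f\<bar> - \<epsilon>) (\<delta>\<^sup>2 / 2 - (1 - z (direction_coord \<theta>)))"
    have "?G z \<le> 0"
    proof (rule corona_trace_le_0[of z 0 UNIV ?G "max 1 R"])
      show "z \<in> corona_trace 0 UNIV" using z by (simp add: corona_trace_UNIV)
      show "continuous_map H\<^sub>0 euclideanreal ?G"
        by (intro continuous_intros coord_dir continuous_map_sublinear_Higson_coordinate f F) auto
      fix x :: 'a assume "dist x 0 > max 1 R"
      then have x: "norm x > 1" "norm x > R" by simp_all
      have "(dist x (norm x *\<^sub>R \<theta>))\<^sup>2 = (norm x)\<^sup>2 * (2 * (1 - direction_coord \<theta> x))"
      proof -
        have "\<theta> \<bullet> \<theta> = 1" using \<theta>(1) by (simp add: norm_eq_1)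
        moreover have "x \<bullet> x = norm x * norm x" by (simp add: power2_norm_eq_inner flip: power2_eq_square)
        ultimately show ?thesis
          unfolding dist_norm power2_norm_eq_inner direction_coord_eq[OF x(1)] using x
          by (simp add: inner_diff_left inner_diff_right inner_commute field_simps power2_eq_square)
      qed
      moreover have "(norm x)\<^sup>2 * (2 * (1 - direction_coord \<theta> x)) < (norm x)\<^sup>2 * \<delta>\<^sup>2"
        if "1 - direction_coord \<theta> x < \<delta>\<^sup>2 / 2"
        using that x by (intro mult_strict_left_mono) auto
      ultimately have "dist x (norm x *\<^sub>R \<theta>) < \<delta> * norm x" if "1 - direction_coord \<theta> x < \<delta>\<^sup>2 / 2"
        using that \<delta> by (intro power2_less_imp_less[of _ "\<delta> * norm x"]) (auto simp: power_mult_distrib mult.commute)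
      then have "\<bar>f x - F x\<bar> < \<epsilon>" if "1 - direction_coord \<theta> x < \<delta>\<^sup>2 / 2"
        using near[OF x(2)] that by (simp add: F_def)
      then show "?G (e\<^sub>0 x) \<le> 0"
        unfolding coord_apply sublinear_Higson_embedding_apply[OF f] sublinear_Higson_embedding_apply[OF F]
        by (force simp: min_le_iff_disj abs_minus_commute)
    qed
    moreover have "z (direction_coord \<theta>) = 1" using \<theta> by (simp add: norm_eq_1)
    moreover have "\<delta>\<^sup>2 > 0" using \<delta> by simp
    ultimately show ?thesis by (simp add: min_le_iff_disj)
  qed
  from this[of "\<bar>z F - z f\<bar> / 2"] have "z F = z f" by (cases "z F = z f") auto
  then show ?thesis unfolding F_def .
qed

section \<open>Combs\<close>

text \<open>The condition \<open>norm x \<le> a \<bullet> x\<close> describes a closed convex cone around \<open>a\<close> without a line.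
  Its part on the nonpositive side of \<open>b\<close> is the spine of the comb; the spheres with radii in \<open>S\<close>
  cut the teeth out of the cone. The spine is the whole cone when \<open>b = 0\<close>.\<close>

definition comb :: "'a::real_inner \<Rightarrow> 'a \<Rightarrow> real set \<Rightarrow> 'a set" where
  "comb a b S = {x. norm x \<le> a \<bullet> x \<and> (b \<bullet> x \<le> 0 \<or> norm x \<in> S)}"

text \<open>The vector \<open>y\<close> spans a ray in the spine. Any point \<open>x\<close> of the comb is joined to this ray at the
  constant norm \<open>\<bar>x\<bar>\<close>, along the radial projection of the segment from \<open>x\<close> to the ray. Since the
  norm is constant, a tooth is not left; since the cone and the spine are convex, the path stays in
  whichever of them contains \<open>x\<close>.\<close>

lemma connected_comb_tail:
  fixes a b y :: "'a::real_inner"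
  assumes y: "y \<noteq> 0" "norm y \<le> a \<bullet> y" "b \<bullet> y \<le> 0" and "r \<ge> 0"
  shows "connected (comb a b S \<inter> {x. norm x > r})"
proof -
  let ?T = "comb a b S \<inter> {x. norm x > r}"
  define y' where "y' = y /\<^sub>R norm y"
  have y': "norm y' = 1" "1 \<le> a \<bullet> y'" "b \<bullet> y' \<le> 0"
    using y by (simp_all add: y'_def divide_simps)
  let ?L = "(\<lambda>t. t *\<^sub>R y') ` {r<..}"
  have L: "connected ?L" "?L \<subseteq> ?T"
  proof -
    show "connected ?L" by (intro connected_continuous_image continuous_intros) simp
    show "?L \<subseteq> ?T"
      using y' \<open>r \<ge> 0\<close> by (auto simp: comb_def mult_nonneg_nonpos mult_le_cancel_left1)
  qed
  define A where "A x = (\<lambda>z. norm x *\<^sub>R (z /\<^sub>R norm z)) ` closed_segment x y'" for x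
  have A: "connected (A x)" "A x \<subseteq> ?T" "x \<in> A x" "norm x *\<^sub>R y' \<in> A x" if x: "x \<in> ?T" for x
  proof -
    have nx: "norm x > r" "x \<noteq> 0" "norm x \<le> a \<bullet> x" using x \<open>r \<ge> 0\<close> by (auto simp: comb_def)
    have seg: "z \<noteq> 0 \<and> norm z \<le> a \<bullet> z \<and> (b \<bullet> x \<le> 0 \<longrightarrow> b \<bullet> z \<le> 0)"
      if "z \<in> closed_segment x y'" for z
    proof -
      obtain u where u: "0 \<le> u" "u \<le> 1" "z = (1 - u) *\<^sub>R x + u *\<^sub>R y'"
        using \<open>z \<in> closed_segment x y'\<close> by (auto simp: closed_segment_def)
      have "norm z \<le> (1 - u) * norm x + u * norm y'"
        unfolding u(3) using u(1,2) by (intro norm_triangle_le) simp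
      also have "\<dots> \<le> (1 - u) * (a \<bullet> x) + u * (a \<bullet> y')"
        using u nx y' by (intro add_mono mult_left_mono) auto
      finally have 1: "norm z \<le> a \<bullet> z" by (simp add: u(3) inner_simps)
      \<comment> \<open>The linear form \<open>a\<close> is positive on the cone, so segments in it avoid the origin and can
        be projected radially.\<close>
      have "0 < (1 - u) * norm x + u * norm y'"
        using u nx y' by (cases "u = 0") (auto intro: add_nonneg_pos)
      also have "\<dots> \<le> (1 - u) * (a \<bullet> x) + u * (a \<bullet> y')"
        using u nx y' by (intro add_mono mult_left_mono) auto
      finally have 2: "z \<noteq> 0" by (auto simp: u(3) inner_simps dest: arg_cong[of _ _ "\<lambda>z. a \<bullet> z"])
      have "b \<bullet> z \<le> 0" if "b \<bullet> x \<le> 0"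
        using that u y' by (simp add: u(3) inner_simps mult_nonneg_nonpos add_nonpos_nonpos)
      with 1 2 show ?thesis by blast
    qed
    show "connected (A x)"
      unfolding A_def using seg
      by (intro connected_continuous_image continuous_intros) auto
    show "A x \<subseteq> ?T"
    proof
      fix z' assume "z' \<in> A x"
      then obtain z where z: "z \<in> closed_segment x y'" "z' = (norm x / norm z) *\<^sub>R z"
        by (auto simp: A_def divide_inverse)
      let ?z = "(norm x / norm z) *\<^sub>R z"
      have c: "norm x / norm z > 0" using nx seg[OF z(1)] by simp
      have n: "norm ?z = norm x" using seg[OF z(1)] by simp
      have "norm x / norm z * norm z \<le> norm x / norm z * (a \<bullet> z)"
        using c seg[OF z(1)] by (intro mult_left_mono) auto
      then have "norm ?z \<le> a \<bullet> ?z" by simp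
      moreover have "b \<bullet> ?z \<le> 0" if "b \<bullet> x \<le> 0"
        using c seg[OF z(1)] that by (simp add: mult_nonneg_nonpos divide_nonpos_nonneg)
      moreover have "b \<bullet> x \<le> 0 \<or> norm x \<in> S" using x by (simp add: comb_def)
      ultimately show "z' \<in> ?T"
        using nx(1) n unfolding z(2) comb_def by (simp only: Int_iff mem_Collect_eq) blast
    qed
    show "x \<in> A x" unfolding A_def using nx by (intro image_eqI[of _ _ x]) auto
    show "norm x *\<^sub>R y' \<in> A x" unfolding A_def using y' by (intro image_eqI[of _ _ y']) auto
  qed
  show ?thesis
  proof (cases "?T = {}")
    case False
    have eq: "?T = \<Union> ((\<lambda>x. A x \<union> ?L) ` ?T)" using A L by blast
    have "connected (\<Union> ((\<lambda>x. A x \<union> ?L) ` ?T))"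
    proof (rule connected_Union)
      fix U assume "U \<in> (\<lambda>x. A x \<union> ?L) ` ?T"
      then obtain x where x: "x \<in> ?T" "U = A x \<union> ?L" by blast
      have "norm x *\<^sub>R y' \<in> A x \<inter> ?L" using A(4)[OF x(1)] x(1) by auto
      then show "connected U" unfolding x(2) using A(1)[OF x(1)] L(1)
        by (intro connected_Un) auto
    next
      have "(r + 1) *\<^sub>R y' \<in> ?L" by auto
      then show "\<Inter> ((\<lambda>x. A x \<union> ?L) ` ?T) \<noteq> {}" using False by blast
    qed
    then show ?thesis using eq by simp
  qed simp
qed


section \<open>Disjoint neighborhoods of two corona points\<close>

text \<open>The neighborhood \<open>N\<close> guarantees that points of the space near \<open>p\<close> have norms in \<open>S\<close>, and the
  strict inequality for \<open>a\<close> that they lie in the cone; so they lie in the teeth.\<close>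

lemma continuum_neighborhood_comb:
  fixes a b y :: "'a::euclidean_space"
  assumes p: "p \<in> topspace Z\<^sub>0" "p (direction_coord a) > 1" "p \<in> N" and N: "openin H\<^sub>0 N"
    and sub: "\<And>x. e\<^sub>0 x \<in> N \<Longrightarrow> norm x \<in> S"
    and y: "norm y = 1" "1 \<le> a \<bullet> y" "b \<bullet> y \<le> 0"
  shows "continuum_neighborhood Z\<^sub>0 p (corona_trace 0 (comb a b S))"
proof (rule continuum_neighborhood_corona_trace)
  let ?N = "N \<inter> {z \<in> topspace H\<^sub>0. z (direction_coord a) \<in> {1<..}}"
  show "connected (comb a b S \<inter> {x. dist x 0 > real n})" for n
    using connected_comb_tail[of y a b "real n" S] y by (cases "y = 0") auto
  show "openin H\<^sub>0 ?N"
    by (intro openin_Int N openin_continuous_map_preimage[OF coord_dir]) simp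
  show "p \<in> ?N" using p by (auto simp: topspace_sublinear_Higson_corona)
  fix x :: 'a assume x: "dist x 0 > 1" "e\<^sub>0 x \<in> ?N"
  then have "direction_coord a x > 1" "x \<noteq> 0" "norm x > 1" "norm x \<in> S"
    using sub by (auto simp: coord_apply)
  then show "x \<in> comb a b S" using direction_coord_eq[of x a] less_divide_eq_1_pos[of "norm x" "a \<bullet> x"]
    by (simp add: comb_def)
qed (rule p)

lemma corona_trace_comb_bounds:
  fixes a b :: "'a::euclidean_space"
  assumes z: "z \<in> corona_trace 0 (comb a b S)" and G: "continuous_map H\<^sub>0 euclideanreal G"
    and GS: "\<And>x. norm x \<in> S \<Longrightarrow> G (e\<^sub>0 x) \<le> 0"
  shows "z (direction_coord a) \<ge> 1" "z (direction_coord b) \<le> 0 \<or> G z \<le> 0"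
proof -
  have "1 - z (direction_coord a) \<le> 0"
  proof (rule corona_trace_le_0[OF z, of "\<lambda>z. 1 - z (direction_coord a)" 1])
    show "continuous_map H\<^sub>0 euclideanreal (\<lambda>z. 1 - z (direction_coord a))"
      by (intro continuous_intros coord_dir) auto
    show "1 - e\<^sub>0 x (direction_coord a) \<le> 0" if "x \<in> comb a b S" "dist x 0 > 1" for x
      using that unfolding coord_apply by (auto simp: direction_coord_eq comb_def le_divide_eq)
  qed
  then show "z (direction_coord a) \<ge> 1" by simp
  have "min (z (direction_coord b)) (G z) \<le> 0"
  proof (rule corona_trace_le_0[OF z, of "\<lambda>z. min (z (direction_coord b)) (G z)" 1])
    show "continuous_map H\<^sub>0 euclideanreal (\<lambda>z. min (z (direction_coord b)) (G z))"
      by (intro continuous_intros coord_dir G)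
    show "min (e\<^sub>0 x (direction_coord b)) (G (e\<^sub>0 x)) \<le> 0" if "x \<in> comb a b S" "dist x 0 > 1" for x
      using that GS unfolding coord_apply
      by (auto simp: direction_coord_eq comb_def min_le_iff_disj divide_le_0_iff)
  qed
  then show "z (direction_coord b) \<le> 0 \<or> G z \<le> 0" by (simp add: min_le_iff_disj)
qed

text \<open>The linear form \<open>\<theta> - \<eta>\<close> takes opposite nonzero values at \<open>\<theta>\<close> and \<open>\<eta>\<close>; a multiple \<open>a\<close> of it
  is large enough for the cones around \<open>a\<close> and \<open>-a\<close> to contain them in their interiors.\<close>

lemma separate_different_directions:
  fixes \<theta> \<eta> :: "'a::euclidean_space"
  assumes p: "p \<in> topspace Z\<^sub>0" "norm \<theta> = 1" "\<And>v. p (direction_coord v) = v \<bullet> \<theta>"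
    and q: "q \<in> topspace Z\<^sub>0" "norm \<eta> = 1" "\<And>v. q (direction_coord v) = v \<bullet> \<eta>"
    and "\<theta> \<noteq> \<eta>"
  shows "disjoint_continuum_neighborhoods Z\<^sub>0 p q"
proof -
  have "1 - \<theta> \<bullet> \<eta> = (norm (\<theta> - \<eta>))\<^sup>2 / 2"
    using p(2) q(2) by (simp add: power2_norm_eq_inner inner_simps norm_eq_1 inner_commute)
  moreover have "(norm (\<theta> - \<eta>))\<^sup>2 > 0" using \<open>\<theta> \<noteq> \<eta>\<close> by simp
  ultimately have k: "1 - \<theta> \<bullet> \<eta> > 0" by linarith
  define a where "a = (2 / (1 - \<theta> \<bullet> \<eta>)) *\<^sub>R (\<theta> - \<eta>)"
  have a: "a \<bullet> \<theta> = 2" "(- a) \<bullet> \<eta> = 2"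
  proof -
    have "(\<theta> - \<eta>) \<bullet> \<theta> = 1 - \<theta> \<bullet> \<eta>" "(\<theta> - \<eta>) \<bullet> \<eta> = - (1 - \<theta> \<bullet> \<eta>)"
      using p(2) q(2) by (simp_all add: inner_diff_left norm_eq_1 inner_commute[of \<eta> \<theta>])
    then show "a \<bullet> \<theta> = 2" "(- a) \<bullet> \<eta> = 2"
      using k unfolding a_def inner_minus_left inner_scaleR_left by (simp_all add: divide_simps)
  qed
  have top: "p \<in> topspace H\<^sub>0" "q \<in> topspace H\<^sub>0"
    using p(1) q(1) by (simp_all add: topspace_sublinear_Higson_corona)
  have "continuum_neighborhood Z\<^sub>0 p (corona_trace 0 (comb a 0 UNIV))"
    by (rule continuum_neighborhood_comb[OF p(1) _ top(1) openin_topspace, of _ _ \<theta>])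
       (use p a in simp_all)
  moreover have "continuum_neighborhood Z\<^sub>0 q (corona_trace 0 (comb (- a) 0 UNIV))"
    by (rule continuum_neighborhood_comb[OF q(1) _ top(2) openin_topspace, of _ _ \<eta>])
       (use q a in simp_all)
  moreover have "False" if z: "z \<in> corona_trace 0 (comb a 0 UNIV)" "z \<in> corona_trace 0 (comb (- a) 0 UNIV)" for z
  proof -
    have "z \<in> topspace Z\<^sub>0" using z by (simp add: corona_trace_def)
    then obtain \<zeta> :: 'a where "\<And>v. z (direction_coord v) = v \<bullet> \<zeta>"
      using corona_point_has_direction by blast
    moreover have "z (direction_coord a) \<ge> 1" "z (direction_coord (- a)) \<ge> 1"
      using corona_trace_comb_bounds(1)[OF z(1), of "\<lambda>_. 0"]
        corona_trace_comb_bounds(1)[OF z(2), of "\<lambda>_. 0"] by auto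
    ultimately show False by simp
  qed
  ultimately show ?thesis unfolding disjoint_continuum_neighborhoods_def by blast
qed

text \<open>The cone of each comb contains \<open>\<theta>\<close> in its interior and the spine meets the cone of the other comb
  only in the origin: the spine of the first has \<open>(\<theta> - w) \<bullet> x \<le> 0\<close>, while the cone of the second requires
  \<open>2 (\<theta> - w) \<bullet> x \<ge> \<bar>x\<bar>\<close>. So far out the combs could only meet in teeth of both, where the radial function
  \<open>F\<close> would be at most \<open>c\<close> and at least \<open>d\<close>.\<close>

lemma separate_same_direction:
  fixes \<theta> :: "'a::euclidean_space"
  assumes "DIM('a) \<ge> 2" and \<theta>: "norm \<theta> = 1"
    and p: "p \<in> topspace Z\<^sub>0" "\<And>v. p (direction_coord v) = v \<bullet> \<theta>"
    and q: "q \<in> topspace Z\<^sub>0" "\<And>v. q (direction_coord v) = v \<bullet> \<theta>"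
    and f: "f \<in> C\<^sub>0" and less: "p f < q f"
  shows "disjoint_continuum_neighborhoods Z\<^sub>0 p q"
proof -
  obtain w' :: 'a where w': "w' \<noteq> 0" "orthogonal \<theta> w'"
    using orthogonal_to_vector_exists[OF assms(1)] by blast
  define w where "w = w' /\<^sub>R norm w'"
  have w: "norm w = 1" "\<theta> \<bullet> w = 0" "w \<bullet> \<theta> = 0"
    using w' by (simp_all add: w_def orthogonal_def inner_commute)
  have sq: "\<theta> \<bullet> \<theta> = 1" "w \<bullet> w = 1" using \<theta> w(1) by (simp_all add: norm_eq_1)
  define F where "F x = f (norm x *\<^sub>R \<theta>)" for x :: 'a
  have F: "F \<in> C\<^sub>0" unfolding F_def by (rule sublinear_Higson_functions_along_ray[OF f \<theta>])
  note coord_F = continuous_map_sublinear_Higson_coordinate[OF F]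
  \<comment> \<open>Since \<open>p\<close> and \<open>q\<close> have the direction \<open>\<theta>\<close>, the radial function \<open>F\<close> separates them as \<open>f\<close> does.\<close>
  have pF: "p F = p f" unfolding F_def by (rule corona_value_along_ray[OF p(1) \<theta> p(2) f])
  have qF: "q F = q f" unfolding F_def by (rule corona_value_along_ray[OF q(1) \<theta> q(2) f])
  obtain c where c: "p f < c" "c < q f" using dense[OF less] by blast
  obtain d where d: "c < d" "d < q f" using dense[OF c(2)] by blast
  let ?S = "{r. f (r *\<^sub>R \<theta>) \<le> c}" and ?T = "{r. f (r *\<^sub>R \<theta>) \<ge> d}"
  let ?a = "2 *\<^sub>R (\<theta> + w)" and ?b = "\<theta> - w" and ?a' = "2 *\<^sub>R (\<theta> - w)" and ?b' = "\<theta> + w"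
  have "continuum_neighborhood Z\<^sub>0 p (corona_trace 0 (comb ?a ?b ?S))"
  proof (rule continuum_neighborhood_comb[where y = w])
    show "openin H\<^sub>0 {z \<in> topspace H\<^sub>0. z F \<in> {..<c}}"
      by (rule openin_continuous_map_preimage[OF coord_F]) simp
    show "p \<in> {z \<in> topspace H\<^sub>0. z F \<in> {..<c}}"
      using p(1) pF c by (simp add: topspace_sublinear_Higson_corona)
    show "norm x \<in> ?S" if "e\<^sub>0 x \<in> {z \<in> topspace H\<^sub>0. z F \<in> {..<c}}" for x
      using that by (simp add: sublinear_Higson_embedding_apply[OF F]) (simp add: F_def)
  qed (use p w sq in \<open>simp_all add: inner_simps\<close>)
  moreover have "continuum_neighborhood Z\<^sub>0 q (corona_trace 0 (comb ?a' ?b' ?T))"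
  proof (rule continuum_neighborhood_comb[where y = "- w"])
    show "openin H\<^sub>0 {z \<in> topspace H\<^sub>0. z F \<in> {d<..}}"
      by (rule openin_continuous_map_preimage[OF coord_F]) simp
    show "q \<in> {z \<in> topspace H\<^sub>0. z F \<in> {d<..}}"
      using q(1) qF d by (simp add: topspace_sublinear_Higson_corona)
    show "norm x \<in> ?T" if "e\<^sub>0 x \<in> {z \<in> topspace H\<^sub>0. z F \<in> {d<..}}" for x
      using that by (simp add: sublinear_Higson_embedding_apply[OF F]) (simp add: F_def)
  qed (use q w sq in \<open>simp_all add: inner_simps\<close>)
  moreover have "False"
    if z: "z \<in> corona_trace 0 (comb ?a ?b ?S)" "z \<in> corona_trace 0 (comb ?a' ?b' ?T)" for z
  proof -
    have "z \<in> topspace Z\<^sub>0" using z by (simp add: corona_trace_def)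
    then obtain \<zeta> :: 'a where \<zeta>: "\<And>v. z (direction_coord v) = v \<bullet> \<zeta>"
      using corona_point_has_direction by blast
    have 1: "z (direction_coord ?a) \<ge> 1" "z (direction_coord ?b) \<le> 0 \<or> z F - c \<le> 0"
      by (rule corona_trace_comb_bounds[OF z(1), of "\<lambda>z. z F - c"];
          (intro continuous_intros coord_F)?;
          simp add: sublinear_Higson_embedding_apply[OF F] F_def)+
    have 2: "z (direction_coord ?a') \<ge> 1" "z (direction_coord ?b') \<le> 0 \<or> d - z F \<le> 0"
      by (rule corona_trace_comb_bounds[OF z(2), of "\<lambda>z. d - z F"];
          (intro continuous_intros coord_F)?;
          simp add: sublinear_Higson_embedding_apply[OF F] F_def)+
    show False using 1 2 d(1) unfolding \<zeta> by auto
  qed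
  ultimately show ?thesis unfolding disjoint_continuum_neighborhoods_def by blast
qed

theorem mutually_aposyndetic_sublinear_Higson_corona:
  assumes "DIM('a::euclidean_space) \<ge> 2"
  shows "mutually_aposyndetic (sublinear_Higson_corona (0::'a))"
proof -
  have "disjoint_continuum_neighborhoods Z\<^sub>0 p q"
    if p: "p \<in> topspace Z\<^sub>0" and q: "q \<in> topspace Z\<^sub>0" and ne: "p \<noteq> q" for p q :: "('a \<Rightarrow> real) \<Rightarrow> real"
  proof -
    obtain \<theta> :: 'a where \<theta>: "norm \<theta> = 1" "\<And>v. p (direction_coord v) = v \<bullet> \<theta>"
      using corona_point_has_direction[OF p] by blast
    obtain \<eta> :: 'a where \<eta>: "norm \<eta> = 1" "\<And>v. q (direction_coord v) = v \<bullet> \<eta>"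
      using corona_point_has_direction[OF q] by blast
    show ?thesis
    proof (cases "\<theta> = \<eta>")
      case False
      then show ?thesis using p q \<theta> \<eta> by (intro separate_different_directions)
    next
      case True
      have "p \<in> extensional C\<^sub>0" "q \<in> extensional C\<^sub>0"
        using p q unfolding topspace_sublinear_Higson_corona sublinear_Higson_compactification_def
        by (auto simp: Let_def PiE_def)
      then obtain f where f: "f \<in> C\<^sub>0" "p f \<noteq> q f" using ne extensionalityI by blast
      then consider "p f < q f" | "q f < p f" by linarith
      then show ?thesis
      proof cases
        case 1
        then show ?thesis using assms p q \<theta> \<eta> True f by (intro separate_same_direction) auto
      next
        case 2
        then have "disjoint_continuum_neighborhoods Z\<^sub>0 q p"
          using assms p q \<theta> \<eta> True f by (intro separate_same_direction) auto
        then show ?thesis unfolding disjoint_continuum_neighborhoods_def by blast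
      qed
    qed
  qed
  then show ?thesis unfolding mutually_aposyndetic_def disjoint_continuum_neighborhoods_def by blast
qed

theorem continuum_sublinear_Higson_corona:
  assumes "DIM('a::euclidean_space) \<ge> 2"
  shows "continuum (sublinear_Higson_corona (0::'a))"
proof -
  have "connected (UNIV \<inter> {x::'a. dist x 0 > real n})" for n
  proof -
    have "UNIV \<inter> {x::'a. dist x 0 > real n} = - cball 0 (real n)" by auto
    moreover have "connected (- cball (0::'a) (real n))"
      using assms by (intro connected_complement_bounded_convex) auto
    ultimately show ?thesis by (simp only:)
  qed
  then have "continuum (subtopology H\<^sub>0 (corona_trace (0::'a) UNIV))"
    by (rule continuum_corona_trace)
  then show ?thesis
    unfolding corona_trace_UNIV topspace_sublinear_Higson_corona
    by (simp add: sublinear_Higson_corona_def)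
qed

end

theorem theorem3p3:
  assumes "CARD('n::finite) \<ge> 2"
  shows "continuum (sublinear_Higson_corona (0 :: real ^ 'n)) \<and>
         mutually_aposyndetic (sublinear_Higson_corona (0 :: real ^ 'n))"
  using assms
  by (simp add: continuum_sublinear_Higson_corona mutually_aposyndetic_sublinear_Higson_corona)

end
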